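(* Let a power grid containing a busbar coupler $s$ (joining two distinct buses) be given, and assume that the grid with open coupler is connected. Let $\boldsymbol B_o$ be the grounded Laplacian of the grid with open coupler and $\boldsymbol B_c^{-1}=\lim_{b_s\to\infty}(\boldsymbol B_o+b_s\boldsymbol\nu_s\boldsymbol\nu_s^\top)^{-1}$. Let $e\neq s$ be a branch whose outage does not disconnect the grid with open coupler. Then the $e$-th column of the LODF matrix of the grid with the open busbar coupler is given by $$\mathbf{LODF}_{:,e}=\left(\frac{1}{1-b_e\boldsymbol\nu_e^\top\boldsymbol B_o^{-1}\boldsymbol\nu_e}\,\mathfrak B_o\boldsymbol E^\top\boldsymbol B_o^{-1}\boldsymbol E-\mathbb 1\right)\boldsymbol u_e,$$ with $$\boldsymbol E^\top\boldsymbol B_o^{-1}\boldsymbol E=\boldsymbol E^\top\boldsymbol B_c^{-1}\boldsymbol E+\Big[\boldsymbol\nu_s^\top\big(\boldsymbol B_o-\boldsymbol B_o\boldsymbol B_c^{-1}\boldsymbol B_o\big)\boldsymbol\nu_s\Big]^{-1}\boldsymbol E^\top\big(\mathbb 1-\boldsymbol B_c^{-1}\boldsymbol B_o\big)\boldsymbol\nu_s\boldsymbol\nu_s^\top\big(\mathbb 1-\boldsymbol B_o\boldsymbol B_c^{-1}\big)\boldsymbol E$$ and $$\boldsymbol\nu_e^\top\boldsymbol B_o^{-1}\boldsymbol\nu_e=\boldsymbol\nu_e^\top\boldsymbol B_c^{-1}\boldsymbol\nu_e+\Big[\boldsymbol\nu_s^\top\big(\boldsymbol B_o-\boldsymbol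 B_o\boldsymbol B_c^{-1}\boldsymbol B_o\big)\boldsymbol\nu_s\Big]^{-1}\boldsymbol\nu_e^\top\big(\mathbb 1-\boldsymbol B_c^{-1}\boldsymbol B_o\big)\boldsymbol\nu_s\boldsymbol\nu_s^\top\big(\mathbb 1-\boldsymbol B_o\boldsymbol B_c^{-1}\big)\boldsymbol\nu_e .$$
   Context: A grid is a finite graph with buses (nodes) $1,\dots,N_n$ and branches (edges) $1,\dots,N_e$, each branch joining two distinct buses (parallel branches allowed) and carrying a fixed orientation. One bus is chosen as slack bus. The grounded node-edge incidence matrix $\boldsymbol E$ has size $(N_n-1)\times N_e$: $E_{n,e}=+1$ if branch $e$ starts at bus $n$, $-1$ if it ends at $n$, $0$ otherwise, with the row of the slack bus removed. $\boldsymbol u_e$ is the $e$-th standard basis vector of $\mathbb R^{N_e}$ and $\boldsymbol\nu_e=\boldsymbol E\boldsymbol u_e$. $\mathbb 1$ is the identity matrix. One of the branches is the busbar coupler $s$, also included as a column of $\boldsymbol E$. All branches $e\neq s$ have susceptance $b_e>0$. The coupler has susceptance $b_s=0$ when open and $b_s\to\infty$ when closed. Let $\mathfrak B_o$ be the diagonal matrix of branch susceptances of the open grid, with entries $b_e$ for $e\ne s$ and $0$ for $e=s$. The grounded Laplacian of the open grid is $\boldsymbol B_o=\boldsymbol E\,\mathfrak B_o\boldsymbol E^\top$; "connected with open coupler" means that the graph with all branches $e\neq s$ is connected, so that $\boldsymbol B_o$ is invertible. For finite $b_s>0$ the grounded Laplacian of the closed (not merged) grid is $\boldsymbol B_o+b_s\boldsymbol\nu_s\boldsymbol\nu_s^\top$.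 The symbol $\boldsymbol B_c^{-1}$ denotes the entrywise limit of its inverse as $b_s\to\infty$ (this limit is a singular matrix, so the symbol is notation and not the inverse of a matrix). The line outage distribution factors (LODFs) describe the change of the branch flows after the outage of a branch: if $\boldsymbol f_o$ is the flow vector in the open grid for some power injections, and $\boldsymbol f_o'$ is the flow vector for the same injections after the outage of branch $e$ (i.e. $b_e$ replaced by $0$), then $\boldsymbol f_o'=\boldsymbol f_o+\mathbf{LODF}_{:,e}\,\boldsymbol u_e^\top\boldsymbol f_o$.
   Formalization: The printed LODF formula is false in its e-th entry (the true value is -1); the formal version has the factor 1/(1-b_e ν_e^T B_o^{-1} ν_e) multiply the whole difference (𝔅_o E^T B_o^{-1} E - 1), and also proves the printed formula for all rows other than e. *)

theory Defs
  imports "HOL-Analysis.Analysis" "Graph_Theory.Digraph_Component"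
begin

text \<open>
  The types \<open>'v\<close> and \<open>'e\<close> are the finite sets of buses and branches; \<open>'n\<close> indexes the rows of
  grounded matrices, and \<open>row_bus\<close> says which non-slack bus a row belongs to.  The value of
  \<open>susceptance\<close> at the coupler is never used.
\<close>

record ('v, 'n, 'e) grid =
  start_bus :: "'e \<Rightarrow> 'v"
  end_bus :: "'e \<Rightarrow> 'v"
  slack :: 'v
  row_bus :: "'n \<Rightarrow> 'v"
  coupler :: 'e
  susceptance :: "'e \<Rightarrow> real"

definition busbar_grid :: "('v::finite, 'n::finite, 'e::finite) grid \<Rightarrow> bool" where
  "busbar_grid G \<longleftrightarrow>
     (\<forall>e. start_bus G e \<noteq> end_bus G e) \<and>
     bij_betw (row_bus G) UNIV (UNIV - {slack G}) \<and>
     (\<forall>e. e \<noteq> coupler G \<longrightarrow> susceptance G e > 0)"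

definition branch_graph :: "('v, 'n, 'e) grid \<Rightarrow> 'e set \<Rightarrow> ('v, 'e) pre_digraph" where
  "branch_graph G F = \<lparr> verts = UNIV, arcs = F, tail = start_bus G, head = end_bus G \<rparr>"

text \<open>
  The graph-theoretic \<open>Digraph_Component.connected\<close> ignores the orientation of arcs; it is not
  the topological notion of the same name.
\<close>

definition connected_by :: "('v, 'n, 'e) grid \<Rightarrow> 'e set \<Rightarrow> bool" where
  "connected_by G F \<longleftrightarrow> Digraph_Component.connected (branch_graph G F)"

definition incidence :: "('v, 'n::finite, 'e::finite) grid \<Rightarrow> real^'e^'n" where
  "incidence G = (\<chi> n e. if start_bus G e = row_bus G n then 1
                         else if end_bus G e = row_bus G n then -1 else 0)"

definition diag_mat :: "('e::finite \<Rightarrow> real) \<Rightarrow> real^'e^'e" where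
  "diag_mat d = (\<chi> i j. if i = j then d i else 0)"

definition outer_prod :: "real^'n::finite \<Rightarrow> real^'m::finite \<Rightarrow> real^'m^'n" where
  "outer_prod x y = (columnvector x :: real^1^'n) ** (rowvector y :: real^'m^1)"

definition open_susceptance :: "('v, 'n, 'e) grid \<Rightarrow> 'e \<Rightarrow> real" where
  "open_susceptance G = (susceptance G)(coupler G := 0)"

definition laplacian :: "('v, 'n::finite, 'e::finite) grid \<Rightarrow> ('e \<Rightarrow> real) \<Rightarrow> real^'n^'n" where
  "laplacian G b = incidence G ** diag_mat b ** transpose (incidence G)"

definition branch_vec :: "('v, 'n::finite, 'e::finite) grid \<Rightarrow> 'e \<Rightarrow> real^'n" where
  "branch_vec G e = incidence G *v axis e 1"

definition closed_laplacian :: "('v, 'n::finite, 'e::finite) grid \<Rightarrow> real \<Rightarrow> real^'n^'n" where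
  "closed_laplacian G bs = laplacian G (open_susceptance G) +
     bs *\<^sub>R outer_prod (branch_vec G (coupler G)) (branch_vec G (coupler G))"

definition closed_inverse :: "('v, 'n::finite, 'e::finite) grid \<Rightarrow> real^'n^'n" where
  "closed_inverse G = Lim at_top (\<lambda>bs. matrix_inv (closed_laplacian G bs))"

text \<open>
  DC power flow: injections \<open>p\<close> at the non-slack buses determine the voltage angles
  (the angle of the slack bus is 0), and the flow on a branch is its susceptance times the
  angle difference between its start and its end.
\<close>

definition flow :: "('v, 'n::finite, 'e::finite) grid \<Rightarrow> ('e \<Rightarrow> real) \<Rightarrow> real^'n \<Rightarrow> real^'e" where
  "flow G b p =
     diag_mat b *v (transpose (incidence G) *v (matrix_inv (laplacian G b) *v p))"

text \<open>
  All components of the flow are covered, including that of the outaged branch, whose flow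
  after the outage is 0.
\<close>

definition is_lodf_column ::
    "('v, 'n::finite, 'e::finite) grid \<Rightarrow> ('e \<Rightarrow> real) \<Rightarrow> 'e \<Rightarrow> real^'e \<Rightarrow> bool" where
  "is_lodf_column G b e c \<longleftrightarrow>
     (\<forall>p. flow G (b(e := 0)) p = flow G b p + (axis e 1 \<bullet> flow G b p) *\<^sub>R c)"

definition lodf :: "('v, 'n::finite, 'e::finite) grid \<Rightarrow> ('e \<Rightarrow> real) \<Rightarrow> real^'e^'e" where
  "lodf G b = (\<chi> l e. (THE c. is_lodf_column G b e c) $ l)"

end

theory Submission
  imports Defs "HOL-Real_Asymp.Real_Asymp"
begin

text \<open>Closing the coupler and removing a branch are both rank-one updates of the open Laplacian,
  which is positive definite because a potential that is constant along the branches of a connected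
  grid and vanishes at the slack bus is zero.  Sherman--Morrison then gives the closed inverse as a
  limit and the flows after the outage; its denominator \<open>d\<close> is nonzero because otherwise the outage
  Laplacian, which is invertible too, would annihilate \<open>B\<^sub>o\<inverse> \<nu>\<^sub>e\<close>.\<close>

section \<open>Rank-one updates\<close>

lemma outer_prod_mult_vec: "outer_prod x y *v z = (y \<bullet> z) *\<^sub>R x"
  by (simp add: outer_prod_def vec_eq_iff matrix_vector_mult_def matrix_matrix_mult_def
      columnvector_def rowvector_def inner_vec_def sum_distrib_left mult_ac)

lemma inner_symmetric_matrix:
  fixes A :: "real^'n^'n"
  assumes "transpose A = A"
  shows "x \<bullet> (A *v y) = (A *v x) \<bullet> y"
  by (metis assms dot_lmul_matrix transpose_matrix_vector)

lemma invertible_matrix_inv: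
  fixes A :: "real^'n^'n"
  assumes "invertible A"
  shows "A ** matrix_inv A = mat 1" "matrix_inv A ** A = mat 1"
  using someI_ex[OF assms[unfolded invertible_def]] by (simp_all add: matrix_inv_def)

lemma invertible_mult_inv_vec:
  fixes A :: "real^'n^'n"
  assumes "invertible A"
  shows "A *v (matrix_inv A *v x) = x" "matrix_inv A *v (A *v x) = x"
  using assms by (simp_all add: matrix_vector_mul_assoc invertible_matrix_inv)

lemma invertible_matrix_inv_eqI:
  fixes A B :: "real^'n^'n"
  assumes "A ** B = mat 1"
  shows "invertible A" "matrix_inv A = B"
proof -
  show "invertible A"
    using assms invertible_right_inverse by blast
  then show "matrix_inv A = B"
    by (metis assms invertible_matrix_inv(2) matrix_mul_assoc matrix_mul_lid matrix_mul_rid)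
qed

lemma transpose_matrix_inv:
  fixes A :: "real^'n^'n"
  assumes "invertible A"
  shows "transpose (matrix_inv A) = matrix_inv (transpose A)"
  by (metis assms invertible_matrix_inv_eqI(2) invertible_matrix_inv(2) matrix_transpose_mul transpose_mat)

text \<open>Applied to the candidate's value at \<open>z\<close>, the updated matrix returns
  \<open>z\<close> plus a multiple of \<open>u\<close>, and the factor
  \<open>t / (1 + t * ?q)\<close> is the one that makes this multiple vanish. For square matrices a
  right inverse suffices.\<close>

lemma sherman_morrison:
  fixes A :: "real^'n^'n"
  assumes A: "invertible A" and nz: "1 + t * (v \<bullet> (matrix_inv A *v u)) \<noteq> 0"
  shows "invertible (A + t *\<^sub>R outer_prod u v)"
    and "matrix_inv (A + t *\<^sub>R outer_prod u v) =
      matrix_inv A - (t / (1 + t * (v \<bullet> (matrix_inv A *v u)))) *\<^sub>R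
        outer_prod (matrix_inv A *v u) (v v* matrix_inv A)"
proof -
  let ?B = "matrix_inv A"
  let ?q = "v \<bullet> (?B *v u)"
  let ?C = "?B - (t / (1 + t * ?q)) *\<^sub>R outer_prod (?B *v u) (v v* ?B)"
  have "(A + t *\<^sub>R outer_prod u v) *v (?C *v z) = z" for z
  proof -
    let ?p = "v \<bullet> (?B *v z)"
    let ?a = "t / (1 + t * ?q) * ?p"
    have C: "?C *v z = ?B *v z - ?a *\<^sub>R (?B *v u)"
      by (simp add: matrix_vector_mult_diff_rdistrib outer_prod_mult_vec dot_lmul_matrix
          flip: scaleR_matrix_vector_assoc)
    have "(A + t *\<^sub>R outer_prod u v) *v (?C *v z)
        = z + (t * (?p - ?a * ?q) - ?a) *\<^sub>R u"
      unfolding C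
      by (simp add: matrix_vector_mult_add_rdistrib matrix_vector_mult_diff_distrib
          matrix_vector_mult_scaleR invertible_mult_inv_vec[OF A] outer_prod_mult_vec
          inner_diff_right algebra_simps flip: scaleR_matrix_vector_assoc)
    also have "t * (?p - ?a * ?q) - ?a = 0"
      using nz by (simp add: field_simps)
    finally show ?thesis
      by simp
  qed
  then have "(A + t *\<^sub>R outer_prod u v) ** ?C = mat 1"
    by (simp add: matrix_eq flip: matrix_vector_mul_assoc)
  then show "invertible (A + t *\<^sub>R outer_prod u v)"
      "matrix_inv (A + t *\<^sub>R outer_prod u v) = ?C"
    by (rule invertible_matrix_inv_eqI)+
qed

text \<open>In the Sherman-Morrison formula only the scalar \<open>t / (1 + t * ?r)\<close> depends
  on \<open>t\<close>, and it tends to \<open>1 / ?r\<close>. The limit maps \<open>u\<close> to 0,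
  hence it is singular.\<close>

lemma tendsto_matrix_inv_rank_one_update:
  fixes A :: "real^'n^'n"
  assumes A: "invertible A" and r: "v \<bullet> (matrix_inv A *v u) > 0"
  shows "((\<lambda>t. matrix_inv (A + t *\<^sub>R outer_prod u v)) \<longlongrightarrow>
      matrix_inv A - (1 / (v \<bullet> (matrix_inv A *v u))) *\<^sub>R
        outer_prod (matrix_inv A *v u) (v v* matrix_inv A)) at_top"
proof -
  let ?r = "v \<bullet> (matrix_inv A *v u)"
  have "((\<lambda>t. t / (1 + t * ?r)) \<longlongrightarrow> 1 / ?r) at_top"
    using r by real_asymp (simp add: inverse_eq_divide)
  then have "((\<lambda>t. matrix_inv A - (t / (1 + t * ?r)) *\<^sub>R
        outer_prod (matrix_inv A *v u) (v v* matrix_inv A)) \<longlongrightarrow>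
      matrix_inv A - (1 / ?r) *\<^sub>R
        outer_prod (matrix_inv A *v u) (v v* matrix_inv A)) at_top"
    by (rule tendsto_diff[OF tendsto_const tendsto_scaleR[OF _ tendsto_const]])
  moreover have "\<forall>\<^sub>F t in at_top. matrix_inv A - (t / (1 + t * ?r)) *\<^sub>R
        outer_prod (matrix_inv A *v u) (v v* matrix_inv A)
      = matrix_inv (A + t *\<^sub>R outer_prod u v)"
    using eventually_gt_at_top[of 0]
  proof eventually_elim
    case (elim t)
    then have "1 + t * ?r \<noteq> 0"
      using r by (smt (verit) mult_pos_pos)
    then show ?case
      using sherman_morrison(2)[OF A] by simp
  qed
  ultimately show ?thesis
    by (rule Lim_transform_eventually)
qed

section \<open>Grounded Laplacians\<close>

lemma branch_vec_nth: "branch_vec G f $ n = incidence G $ n $ f"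
  by (simp add: branch_vec_def matrix_vector_mult_basis column_def)

lemma vec_mult_incidence: "x v* incidence G = (\<chi> f. branch_vec G f \<bullet> x)"
  by (simp add: vec_eq_iff vector_matrix_mult_def inner_vec_def branch_vec_nth mult_ac)

lemma incidence_mult_vec: "incidence G *v y = (\<Sum>f\<in>UNIV. y $ f *\<^sub>R branch_vec G f)"
  by (simp add: vec_eq_iff matrix_vector_mult_def branch_vec_nth mult_ac)

lemma diag_mat_mult_vec: "diag_mat d *v y = (\<chi> f. d f * y $ f)"
  by (simp add: vec_eq_iff matrix_vector_mult_def diag_mat_def if_distrib[of "\<lambda>a. a * _"]
      cong: if_cong)

lemma laplacian_mult_vec:
  "laplacian G b *v x = (\<Sum>f\<in>UNIV. (b f * (branch_vec G f \<bullet> x)) *\<^sub>R branch_vec G f)"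
  by (simp add: laplacian_def diag_mat_mult_vec vec_mult_incidence incidence_mult_vec
      flip: matrix_vector_mul_assoc)

lemma inner_laplacian:
  "y \<bullet> (laplacian G b *v x) = (\<Sum>f\<in>UNIV. b f * (branch_vec G f \<bullet> x) * (branch_vec G f \<bullet> y))"
  by (simp add: laplacian_mult_vec inner_sum_right inner_commute)

lemma transpose_laplacian: "transpose (laplacian G b) = laplacian G b"
proof -
  have "transpose (diag_mat b) = diag_mat b"
    by (auto simp: transpose_def diag_mat_def vec_eq_iff)
  then show ?thesis
    by (simp add: laplacian_def matrix_transpose_mul matrix_mul_assoc)
qed

text \<open>This brings an outage under Sherman-Morrison, with \<open>t = - b e\<close>.\<close>

lemma laplacian_fun_upd:
  "laplacian G (b(e := a)) =
    laplacian G b + (a - b e) *\<^sub>R outer_prod (branch_vec G e) (branch_vec G e)"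
proof -
  have "laplacian G (b(e := a)) *v x =
    (laplacian G b + (a - b e) *\<^sub>R outer_prod (branch_vec G e) (branch_vec G e)) *v x" for x
    by (simp add: laplacian_mult_vec matrix_vector_mult_add_rdistrib outer_prod_mult_vec
        sum.remove[of UNIV e] algebra_simps flip: scaleR_matrix_vector_assoc)
  then show ?thesis
    by (simp add: matrix_eq)
qed

text \<open>The voltage angle at every bus: the slack bus has no row, so its sum is empty.\<close>

definition potential :: "('v, 'n::finite, 'e) grid \<Rightarrow> real^'n \<Rightarrow> 'v \<Rightarrow> real" where
  "potential G x v = (\<Sum>n | row_bus G n = v. x $ n)"

lemma potential_slack: "busbar_grid G \<Longrightarrow> potential G x (slack G) = 0"
  by (auto simp: potential_def busbar_grid_def bij_betw_def intro!: sum.neutral)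

lemma potential_row_bus: "busbar_grid G \<Longrightarrow> potential G x (row_bus G n) = x $ n"
proof -
  assume "busbar_grid G"
  then have "{m. row_bus G m = row_bus G n} = {n}"
    by (auto simp: busbar_grid_def bij_betw_def inj_def)
  then show ?thesis
    by (simp add: potential_def)
qed

lemma branch_vec_inner:
  assumes "busbar_grid G"
  shows "branch_vec G f \<bullet> x = potential G x (start_bus G f) - potential G x (end_bus G f)"
proof -
  \<comment> \<open>For a self-loop the nested conditional in \<open>incidence\<close> would yield 1
    instead of 1 - 1.\<close>
  have "start_bus G f \<noteq> end_bus G f"
    using assms by (simp add: busbar_grid_def)
  then have "branch_vec G f \<bullet> x = (\<Sum>n\<in>UNIV. (if row_bus G n = start_bus G f then x $ n else 0)
      - (if row_bus G n = end_bus G f then x $ n else 0))"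
    unfolding inner_vec_def by (intro sum.cong) (auto simp: branch_vec_nth incidence_def)
  then show ?thesis
    by (simp add: potential_def sum_subtractf flip: sum.inter_filter)
qed

text \<open>Potentials separate buses: the unit vector of a row raises the angle of its own bus
  only. Of two distinct buses at least one is not the slack bus and so has a row.\<close>

lemma branch_vec_nonzero:
  assumes "busbar_grid G"
  shows "branch_vec G f \<noteq> 0"
proof
  assume "branch_vec G f = 0"
  then have eq: "potential G x (start_bus G f) = potential G x (end_bus G f)" for x
    using branch_vec_inner[OF assms, of f x] by simp
  have neq: "start_bus G f \<noteq> end_bus G f"
    using assms by (simp add: busbar_grid_def)
  have rows: "\<exists>n. v = row_bus G n" if "v \<noteq> slack G" for v
    using assms that by (auto simp: busbar_grid_def bij_betw_def)
  \<comment> \<open>Only \<open>v\<close> is required to have a row. Either end of the branch may be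
    the slack bus, so the fact is used in both orders.\<close>
  have *: "v = w" if "v \<noteq> slack G" and "\<And>x. potential G x v = potential G x w" for v w
  proof -
    obtain n where n: "v = row_bus G n"
      using rows \<open>v \<noteq> slack G\<close> by blast
    have "potential G (axis n 1) w = 1"
      using that(2)[of "axis n 1"] n potential_row_bus[OF assms] by simp
    moreover from this have "w \<noteq> slack G"
      using potential_slack[OF assms] by (metis zero_neq_one)
    then obtain m where "w = row_bus G m"
      using rows by blast
    ultimately show ?thesis
      using n potential_row_bus[OF assms] by (auto simp: axis_def split: if_splits)
  qed
  show False
    using neq eq *[of "start_bus G f" "end_bus G f"] *[of "end_bus G f" "start_bus G f"]
    by metis
qed

text \<open>Induction along a path in the symmetric closure; equality of the two end values does not
  depend on the direction in which a branch is traversed.\<close>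

lemma connected_by_constant:
  assumes "connected_by G F"
    and "\<And>f. f \<in> F \<Longrightarrow> \<theta> (start_bus G f) = \<theta> (end_bus G f)"
  shows "\<theta> u = \<theta> v"
proof -
  let ?S = "mk_symmetric (branch_graph G F)"
  have "u \<rightarrow>\<^sup>*\<^bsub>?S\<^esub> v"
    using assms(1) by (simp add: connected_by_def Digraph_Component.connected_def
        strongly_connected_def branch_graph_def)
  then have "(u, v) \<in> (arcs_ends ?S)\<^sup>*"
    by (rule reachable_rtranclI)
  then show ?thesis
    by induction (auto simp: parcs_mk_symmetric branch_graph_def assms(2))
qed

text \<open>The quadratic form is the sum of \<open>b f\<close> times squared angle differences. If
  it is not positive, the potential is constant along \<open>F\<close>, hence everywhere, and
  grounding at the slack bus makes it 0. Keeping \<open>F\<close> separate from \<open>b\<close>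
  lets the lemma serve both the open grid and the grid after the outage.\<close>

lemma laplacian_pos_def:
  assumes "busbar_grid G" and "connected_by G F"
    and pos: "\<And>f. f \<in> F \<Longrightarrow> b f > 0" and nonneg: "\<And>f. b f \<ge> 0"
    and "x \<noteq> 0"
  shows "x \<bullet> (laplacian G b *v x) > 0"
proof (rule ccontr)
  assume "\<not> ?thesis"
  then have "(\<Sum>f\<in>UNIV. b f * (branch_vec G f \<bullet> x)\<^sup>2) \<le> 0"
    by (simp add: inner_laplacian power2_eq_square mult.assoc)
  then have "b f * (branch_vec G f \<bullet> x)\<^sup>2 = 0" for f
    using sum_nonneg_eq_0_iff[of UNIV "\<lambda>f. b f * (branch_vec G f \<bullet> x)\<^sup>2"] nonneg
      sum_nonneg[of UNIV "\<lambda>f. b f * (branch_vec G f \<bullet> x)\<^sup>2"]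
    by (metis (no_types, lifting) UNIV_I antisym finite mult_nonneg_nonneg zero_le_power2)
  then have "branch_vec G f \<bullet> x = 0" if "f \<in> F" for f
    using pos[OF that] by (metis less_irrefl mult_eq_0_iff zero_eq_power2)
  then have "potential G x u = potential G x v" for u v
    using \<open>connected_by G F\<close> connected_by_constant[of G F "potential G x"]
      branch_vec_inner[OF \<open>busbar_grid G\<close>] by fastforce
  then have "x $ n = 0" for n
    using potential_slack potential_row_bus \<open>busbar_grid G\<close> by metis
  then show False
    using \<open>x \<noteq> 0\<close> by (simp add: vec_eq_iff)
qed

lemma invertible_pos_def:
  fixes A :: "real^'n^'n"
  assumes "\<And>x. x \<noteq> 0 \<Longrightarrow> x \<bullet> (A *v x) > 0"
  shows "invertible A"
  unfolding invertible_left_inverse matrix_left_invertible_ker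
  using assms by fastforce

text \<open>The form of the inverse at \<open>x\<close> is the form of \<open>A\<close> at
  \<open>matrix_inv A *v x\<close>.\<close>

lemma inner_matrix_inv_pos:
  fixes A :: "real^'n^'n"
  assumes pos: "\<And>x. x \<noteq> 0 \<Longrightarrow> x \<bullet> (A *v x) > 0" and "x \<noteq> 0"
  shows "x \<bullet> (matrix_inv A *v x) > 0"
proof -
  have A: "invertible A"
    using pos by (rule invertible_pos_def)
  have "matrix_inv A *v x \<noteq> 0"
    using \<open>x \<noteq> 0\<close> invertible_mult_inv_vec(1)[OF A, of x] by fastforce
  from pos[OF this] show ?thesis
    by (simp add: invertible_mult_inv_vec[OF A] inner_commute)
qed

lemma open_susceptance_nonneg: "busbar_grid G \<Longrightarrow> open_susceptance G f \<ge> 0"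
  by (auto simp: busbar_grid_def open_susceptance_def intro: less_imp_le)

lemma open_susceptance_pos: "busbar_grid G \<Longrightarrow> f \<noteq> coupler G \<Longrightarrow> open_susceptance G f > 0"
  by (auto simp: busbar_grid_def open_susceptance_def)

section \<open>Line outages\<close>

lemma outage_denominator_nonzero:
  fixes G :: "('v, 'n::finite, 'e::finite) grid"
  assumes L: "invertible (laplacian G b)" and L': "invertible (laplacian G (b(e := 0)))"
  shows "1 - b e * (branch_vec G e \<bullet> (matrix_inv (laplacian G b) *v branch_vec G e)) \<noteq> 0"
proof
  let ?\<nu> = "branch_vec G e"
  let ?w = "matrix_inv (laplacian G b) *v ?\<nu>"
  assume d: "1 - b e * (?\<nu> \<bullet> ?w) = 0"
  have "laplacian G (b(e := 0)) *v ?w = (1 - b e * (?\<nu> \<bullet> ?w)) *\<^sub>R ?\<nu>"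
    by (simp add: laplacian_fun_upd matrix_vector_mult_add_rdistrib outer_prod_mult_vec
        invertible_mult_inv_vec[OF L] matrix_vector_mult_diff_rdistrib algebra_simps
        flip: scaleR_matrix_vector_assoc)
  then have "?w = 0"
    using d invertible_mult_inv_vec(2)[OF L', of ?w] by simp
  then show False
    using d by simp
qed

lemma flow_nth:
  "flow G b p $ f = b f * (branch_vec G f \<bullet> (matrix_inv (laplacian G b) *v p))"
  by (simp add: flow_def diag_mat_mult_vec vec_mult_incidence)

text \<open>By Sherman-Morrison the outage shifts the angles by a multiple of \<open>w\<close>; the
  factor is the flow on \<open>e\<close> before the outage divided by \<open>d\<close>. Multiplying
  by the susceptances gives the flow changes on all other branches.\<close>

lemma is_lodf_column_outage:
  fixes G :: "('v, 'n::finite, 'e::finite) grid"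
  assumes L: "invertible (laplacian G b)" and L': "invertible (laplacian G (b(e := 0)))"
  defines "w \<equiv> matrix_inv (laplacian G b) *v branch_vec G e"
  defines "d \<equiv> 1 - b e * (branch_vec G e \<bullet> w)"
  shows "is_lodf_column G b e (\<chi> f. (b f * (branch_vec G f \<bullet> w) - axis e 1 $ f) / d)"
  unfolding is_lodf_column_def
proof
  fix p
  let ?L = "laplacian G b"
  let ?\<nu> = "branch_vec G e"
  let ?\<phi> = "flow G b p $ e"
  have d: "d \<noteq> 0"
    unfolding d_def w_def by (rule outage_denominator_nonzero[OF L L'])
  have "matrix_inv (laplacian G (b(e := 0)))
      = matrix_inv ?L + (b e / d) *\<^sub>R outer_prod w (?\<nu> v* matrix_inv ?L)"
    using sherman_morrison(2)[OF L, of "- b e" ?\<nu> ?\<nu>] d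
    by (simp add: laplacian_fun_upd d_def w_def)
  then have inv': "matrix_inv (laplacian G (b(e := 0))) *v p
      = matrix_inv ?L *v p + (?\<phi> / d) *\<^sub>R w"
    by (simp add: matrix_vector_mult_add_rdistrib outer_prod_mult_vec dot_lmul_matrix flow_nth
        flip: scaleR_matrix_vector_assoc)
  show "flow G (b(e := 0)) p = flow G b p + (axis e 1 \<bullet> flow G b p) *\<^sub>R
      (\<chi> f. (b f * (branch_vec G f \<bullet> w) - axis e 1 $ f) / d)"
    unfolding vec_eq_iff
  proof
    fix f
    show "flow G (b(e := 0)) p $ f = (flow G b p + (axis e 1 \<bullet> flow G b p) *\<^sub>R
        (\<chi> f. (b f * (branch_vec G f \<bullet> w) - axis e 1 $ f) / d)) $ f"
    proof (cases "f = e")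
      \<comment> \<open>The flow on \<open>e\<close> drops to 0, so this entry must be -1; it is,
        because \<open>b e * (?\<nu> \<bullet> w) = 1 - d\<close>.\<close>
      case True
      have "(b e * (?\<nu> \<bullet> w) - 1) / d = -1"
        using d by (simp add: d_def field_simps)
      then show ?thesis
        using True by (simp add: flow_nth inner_axis' del: times_divide_eq_right)
    next
      case False
      then have "axis e (1::real) $ f = 0"
        by (simp add: axis_def)
      with False show ?thesis
        by (simp add: flow_nth[of _ "b(e := 0)"] inv' inner_axis' inner_add_right
            flow_nth[of G b p f] distrib_left mult.left_commute)
    qed
  qed
qed

text \<open>An injection constrains the column only through its multiple by the flow on
  \<open>e\<close>, so a single injection that loads \<open>e\<close> determines it.\<close>

lemma is_lodf_column_unique:
  assumes "is_lodf_column G b e c" and "is_lodf_column G b e c'"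
    and "flow G b p $ e \<noteq> 0"
  shows "c = c'"
  using assms by (auto simp: is_lodf_column_def inner_axis' dest!: spec[of _ p])

section \<open>The closed coupler\<close>

text \<open>With \<open>w = A\<inverse> u\<close> and \<open>r = u \<bullet> w\<close>, the matrix \<open>C = A\<inverse> - (1 / r) w w\<^sup>T\<close> satisfies
  \<open>(1 - C A) u = (u \<bullet> u / r) w\<close> and \<open>A - A C A = (1 / r) u u\<^sup>T\<close>, so the correction \<open>w w\<^sup>T\<close> can be
  rebuilt from \<open>A\<close> and \<open>C\<close>.\<close>

lemma matrix_inv_eq_closed_plus_rank_one:
  fixes A C :: "real^'n^'n" and u :: "real^'n"
  assumes A: "invertible A" and sym: "transpose A = A"
    and "u \<noteq> 0" and r: "u \<bullet> (matrix_inv A *v u) \<noteq> 0"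
    and C: "C = matrix_inv A - (1 / (u \<bullet> (matrix_inv A *v u))) *\<^sub>R
        outer_prod (matrix_inv A *v u) (u v* matrix_inv A)"
  defines "k \<equiv> u \<bullet> ((A - A ** C ** A) *v u)"
  shows "k \<noteq> 0"
    and "matrix_inv A = C + inverse k *\<^sub>R
      ((mat 1 - C ** A) ** outer_prod u u ** (mat 1 - A ** C))"
proof -
  let ?w = "matrix_inv A *v u"
  let ?r = "u \<bullet> ?w"
  let ?q = "u \<bullet> u"
  have "?q \<noteq> 0"
    using \<open>u \<noteq> 0\<close> by simp
  \<comment> \<open>Symmetry identifies the row factor \<open>u v* matrix_inv A\<close> in
    \<open>C\<close> with \<open>?w\<close>.\<close>
  have symi: "transpose (matrix_inv A) = matrix_inv A"
    by (simp add: transpose_matrix_inv[OF A] sym)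
  have Cz: "C *v z = matrix_inv A *v z - ((?w \<bullet> z) / ?r) *\<^sub>R ?w" for z
    by (simp add: C matrix_vector_mult_diff_rdistrib outer_prod_mult_vec dot_lmul_matrix
        inner_symmetric_matrix[OF symi, of u z] flip: scaleR_matrix_vector_assoc)
  have wA: "?w \<bullet> (A *v z) = u \<bullet> z" for z
    by (simp add: inner_symmetric_matrix[OF sym] invertible_mult_inv_vec[OF A])
  have left: "(mat 1 - C ** A) *v u = (?q / ?r) *\<^sub>R ?w"
    by (simp add: matrix_vector_mult_diff_rdistrib Cz wA invertible_mult_inv_vec[OF A]
        flip: matrix_vector_mul_assoc)
  have right: "u \<bullet> ((mat 1 - A ** C) *v z) = ?q / ?r * (?w \<bullet> z)" for z
    by (simp add: matrix_vector_mult_diff_rdistrib matrix_vector_mult_diff_distrib Cz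
        invertible_mult_inv_vec[OF A] matrix_vector_mult_scaleR inner_diff_right
        flip: matrix_vector_mul_assoc)
  have "k = u \<bullet> (A *v ((mat 1 - C ** A) *v u))"
    by (simp add: k_def matrix_vector_mult_diff_rdistrib matrix_vector_mult_diff_distrib
        flip: matrix_vector_mul_assoc)
  also have "\<dots> = ?q\<^sup>2 / ?r"
    by (simp add: left matrix_vector_mult_scaleR invertible_mult_inv_vec[OF A] power2_eq_square)
  finally have k: "k = ?q\<^sup>2 / ?r" .
  then show "k \<noteq> 0"
    using \<open>?q \<noteq> 0\<close> r by simp
  \<comment> \<open>Each of the two outer factors contributes \<open>?q / ?r\<close>; dividing by
    \<open>k\<close> leaves exactly the coefficient that \<open>C\<close> subtracts.\<close>
  have "inverse k * (?q / ?r) * (?q / ?r) = 1 / ?r"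
    using \<open>?q \<noteq> 0\<close> r by (simp add: k field_simps power2_eq_square)
  then have scal: "inverse k * ((?q / ?r * p) * (?q / ?r)) = p / ?r" for p
    by (simp only: mult.assoc mult.left_commute[of _ p] mult_1_right flip: times_divide_eq_right) simp
  have "matrix_inv A *v z = (C + inverse k *\<^sub>R
      ((mat 1 - C ** A) ** outer_prod u u ** (mat 1 - A ** C))) *v z" for z
  proof -
    have "(C + inverse k *\<^sub>R ((mat 1 - C ** A) ** outer_prod u u ** (mat 1 - A ** C))) *v z
        = C *v z + (inverse k * ((?q / ?r * (?w \<bullet> z)) * (?q / ?r))) *\<^sub>R ?w"
      by (simp only: matrix_vector_mult_add_rdistrib left right outer_prod_mult_vec
          matrix_vector_mult_scaleR scaleR_scaleR
          flip: matrix_vector_mul_assoc scaleR_matrix_vector_assoc)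
    also have "\<dots> = matrix_inv A *v z"
      by (simp only: scal Cz) simp
    finally show ?thesis ..
  qed
  then show "matrix_inv A = C + inverse k *\<^sub>R
      ((mat 1 - C ** A) ** outer_prod u u ** (mat 1 - A ** C))"
    by (simp add: matrix_eq)
qed

text \<open>The conjuncts on invertibility, convergence and unique existence ensure that
  \<open>matrix_inv\<close>, \<open>Lim\<close> and \<open>THE\<close> denote the intended objects.
  The column is \<open>(M - mat 1) / d\<close> applied to \<open>axis e 1\<close>: its entry at
  \<open>e\<close> is \<open>((1 - d) - 1) / d = -1\<close>, as a vanishing flow demands. The
  bracketing \<open>(1 / d) M - mat 1\<close> would give \<open>(1 - d) / d - 1\<close> there, which
  differs since \<open>d < 1\<close>. Off \<open>e\<close> the identity contributes nothing and both
  forms agree.\<close>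

theorem corollary2:
  fixes G :: "('v::finite, 'n::finite, 'e::finite) grid"
    and s e :: 'e
    and b :: "'e \<Rightarrow> real"
    and E :: "real^'e^'n"
    and D M :: "real^'e^'e"
    and Bo Bo_inv Bc_inv :: "real^'n^'n"
    and \<nu>s \<nu>e :: "real^'n"
    and d k :: real
  assumes grid: "busbar_grid G"
    and s: "s = coupler G"
    and connected_open: "connected_by G (UNIV - {s})"
    and e: "e \<noteq> s"
    and connected_outage: "connected_by G (UNIV - {s, e})"
    and b: "b = open_susceptance G"
    and E: "E = incidence G"
    and D: "D = diag_mat b"
    and Bo: "Bo = laplacian G b"
    and Bo_inv: "Bo_inv = matrix_inv Bo"
    and Bc_inv: "Bc_inv = closed_inverse G"
    and \<nu>s: "\<nu>s = branch_vec G s"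
    and \<nu>e: "\<nu>e = branch_vec G e"
    and M: "M = D ** transpose E ** Bo_inv ** E"
    and d: "d = 1 - b e * (\<nu>e \<bullet> (Bo_inv *v \<nu>e))"
    and k: "k = \<nu>s \<bullet> ((Bo - Bo ** Bc_inv ** Bo) *v \<nu>s)"
  shows
    "invertible Bo \<and>
     invertible (laplacian G (b(e := 0))) \<and>
     (\<forall>bs>0. invertible (closed_laplacian G bs)) \<and>
     ((\<lambda>bs. matrix_inv (closed_laplacian G bs)) \<longlongrightarrow> Bc_inv) at_top \<and>
     d \<noteq> 0 \<and>
     k \<noteq> 0 \<and>
     (\<exists>!c. is_lodf_column G b e c) \<and>
     column e (lodf G b) = (1 / d) *\<^sub>R ((M - mat 1) *v axis e 1) \<and>
     (\<forall>l. l \<noteq> e \<longrightarrow> column e (lodf G b) $ l = (((1 / d) *\<^sub>R M - mat 1) *v axis e 1) $ l) \<and>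
     transpose E ** Bo_inv ** E =
       transpose E ** Bc_inv ** E +
       inverse k *\<^sub>R (transpose E ** (mat 1 - Bc_inv ** Bo) ** outer_prod \<nu>s \<nu>s
                        ** (mat 1 - Bo ** Bc_inv) ** E) \<and>
     \<nu>e \<bullet> (Bo_inv *v \<nu>e) =
       \<nu>e \<bullet> (Bc_inv *v \<nu>e) +
       inverse k * (\<nu>e \<bullet> (((mat 1 - Bc_inv ** Bo) ** outer_prod \<nu>s \<nu>s
                        ** (mat 1 - Bo ** Bc_inv)) *v \<nu>e))"
proof -
  have pos: "x \<bullet> (Bo *v x) > 0" if "x \<noteq> 0" for x
    unfolding Bo b
    using grid connected_open by (rule laplacian_pos_def)
      (use that in \<open>auto simp: s open_susceptance_pos[OF grid] open_susceptance_nonneg[OF grid]\<close>)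
  have pos': "x \<bullet> (laplacian G (b(e := 0)) *v x) > 0" if "x \<noteq> 0" for x
    unfolding b
    using grid connected_outage by (rule laplacian_pos_def)
      (use that in \<open>auto simp: s open_susceptance_pos[OF grid] open_susceptance_nonneg[OF grid]\<close>)
  have inv: "invertible Bo" and inv': "invertible (laplacian G (b(e := 0)))"
    using pos pos' by (blast intro: invertible_pos_def)+
  have nz: "\<nu>s \<noteq> 0" "\<nu>e \<noteq> 0"
    by (simp_all add: \<nu>s \<nu>e branch_vec_nonzero[OF grid])
  have r: "\<nu>s \<bullet> (Bo_inv *v \<nu>s) > 0" "\<nu>e \<bullet> (Bo_inv *v \<nu>e) > 0"
    using nz pos by (simp_all add: Bo_inv inner_matrix_inv_pos)
  have closed: "closed_laplacian G bs = Bo + bs *\<^sub>R outer_prod \<nu>s \<nu>s" for bs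
    by (simp add: closed_laplacian_def Bo b \<nu>s s)
  have inv_closed: "invertible (closed_laplacian G bs)" if "bs > 0" for bs
  proof -
    have "1 + bs * (\<nu>s \<bullet> (matrix_inv Bo *v \<nu>s)) \<noteq> 0"
      using that r(1) by (smt (verit) Bo_inv mult_pos_pos)
    then show ?thesis
      unfolding closed by (rule sherman_morrison(1)[OF inv])
  qed
  let ?C = "matrix_inv Bo - (1 / (\<nu>s \<bullet> (matrix_inv Bo *v \<nu>s))) *\<^sub>R
      outer_prod (matrix_inv Bo *v \<nu>s) (\<nu>s v* matrix_inv Bo)"
  have lim: "((\<lambda>bs. matrix_inv (closed_laplacian G bs)) \<longlongrightarrow> ?C) at_top"
    using tendsto_matrix_inv_rank_one_update[OF inv] r(1) by (simp add: closed Bo_inv)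
  \<comment> \<open>\<open>closed_inverse\<close> is a \<open>Lim\<close>, so its value is known
    only once convergence is proved.\<close>
  then have Bc: "Bc_inv = ?C"
    by (simp add: Bc_inv closed_inverse_def tendsto_Lim)
  have rank_one: "k \<noteq> 0" "Bo_inv = Bc_inv + inverse k *\<^sub>R
      ((mat 1 - Bc_inv ** Bo) ** outer_prod \<nu>s \<nu>s ** (mat 1 - Bo ** Bc_inv))"
    using matrix_inv_eq_closed_plus_rank_one[OF inv _ nz(1) _ Bc] r(1)
    by (simp_all add: Bo_inv k Bo transpose_laplacian)
  have d0: "d \<noteq> 0"
    using outage_denominator_nonzero[OF inv[unfolded Bo] inv'] by (simp add: d Bo_inv Bo \<nu>e)
  have Mnth: "(M *v axis e 1) $ f = b f * (branch_vec G f \<bullet> (Bo_inv *v \<nu>e))" for f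
    by (simp add: M D E \<nu>e branch_vec_def[of G e] diag_mat_mult_vec vec_mult_incidence
        flip: matrix_vector_mul_assoc)
  define c where "c = (1 / d) *\<^sub>R ((M - mat 1) *v axis e 1)"
  have "c = (\<chi> f. (b f * (branch_vec G f \<bullet> (Bo_inv *v \<nu>e)) - axis e 1 $ f) / d)"
    by (simp add: c_def vec_eq_iff matrix_vector_mult_diff_rdistrib Mnth)
  then have lodf: "is_lodf_column G b e c"
    using is_lodf_column_outage[OF inv[unfolded Bo] inv'] by (simp add: d Bo_inv Bo \<nu>e)
  \<comment> \<open>The injection \<open>\<nu>e\<close> feeds in one unit at the start of
    \<open>e\<close> and withdraws it at the end; its flow on \<open>e\<close> is
    \<open>b e * (\<nu>e \<bullet> (Bo_inv *v \<nu>e))\<close>, a product of positive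
    numbers.\<close>
  have "flow G b \<nu>e $ e \<noteq> 0"
    using r(2) open_susceptance_pos[OF grid, of e] e
    by (simp add: flow_nth Bo_inv Bo \<nu>e b s)
  then have unique: "c' = c" if "is_lodf_column G b e c'" for c'
    using is_lodf_column_unique that lodf by blast
  have ex1: "\<exists>!c. is_lodf_column G b e c"
    using lodf unique by blast
  have "(THE c. is_lodf_column G b e c) = c"
    using lodf unique by blast
  then have col: "column e (lodf G b) = c"
    by (simp add: lodf_def column_def vec_eq_iff)
  have off: "c $ l = (((1 / d) *\<^sub>R M - mat 1) *v axis e 1) $ l" if "l \<noteq> e" for l
    using that by (simp add: c_def matrix_vector_mult_diff_rdistrib axis_def
        flip: scaleR_matrix_vector_assoc)
  let ?R = "(mat 1 - Bc_inv ** Bo) ** outer_prod \<nu>s \<nu>s ** (mat 1 - Bo ** Bc_inv)"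
  have id1: "transpose E ** Bo_inv ** E = transpose E ** Bc_inv ** E +
       inverse k *\<^sub>R (transpose E ** (mat 1 - Bc_inv ** Bo) ** outer_prod \<nu>s \<nu>s
                        ** (mat 1 - Bo ** Bc_inv) ** E)"
    by (subst rank_one(2))
      (simp add: matrix_eq matrix_vector_mult_add_rdistrib matrix_vector_right_distrib
        matrix_vector_mult_scaleR del: transpose_matrix_vector
        flip: matrix_vector_mul_assoc scaleR_matrix_vector_assoc)
  have "\<nu>e \<bullet> (Bo_inv *v \<nu>e) = \<nu>e \<bullet> ((Bc_inv + inverse k *\<^sub>R ?R) *v \<nu>e)"
    using rank_one(2) by simp
  also have "\<dots> = \<nu>e \<bullet> (Bc_inv *v \<nu>e) + inverse k * (\<nu>e \<bullet> (?R *v \<nu>e))"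
    by (simp add: matrix_vector_mult_add_rdistrib inner_add_right
        flip: scaleR_matrix_vector_assoc)
  finally have id2: "\<nu>e \<bullet> (Bo_inv *v \<nu>e) =
      \<nu>e \<bullet> (Bc_inv *v \<nu>e) + inverse k * (\<nu>e \<bullet> (?R *v \<nu>e))" .
  show ?thesis
    using inv inv' inv_closed lim d0 rank_one(1) ex1 off id1 id2
    by (simp add: Bc col c_def)
qed

end
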